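(* Let $K$ be a field of characteristic zero, let $R = K[x,y]$, and let $I$ be a lex-segment ideal in $R$. Then $\operatorname{depth} \operatorname{gr}_I(R) > 0$ if and only if $\operatorname{depth} F(I) > 0$.
   Context: Let $\mathcal{M} = (x,y) \subset R = K[x,y]$, with the variables ordered $x > y$. A graded ideal $I$ of $R$ is a lex-segment ideal if for each degree $e$ with $I_e \neq 0$, the graded component $I_e$ is spanned by an initial lex-segment, i.e. by monomials $x^e, x^{e-1}y, \ldots, x^{e-j}y^j$ for some $0 \le j \le e$. Lex-segment ideals are taken to be nonzero and proper; equivalently, $I = (x^d, x^{d-1}y^{a_1}, \ldots, x^{d-k}y^{a_k})$ for some integers $d \geq 1$, $0 \leq k \leq d$ and $1 \leq a_1 < a_2 < \cdots < a_k$ (for $k=0$ this means $I = (x^d)$). The associated graded ring of $I$ is $\operatorname{gr}_I(R) = \bigoplus_{n \geq 0} I^n/I^{n+1}$, and the fiber cone of $I$ is $F(I) = \bigoplus_{n \geq 0} I^n/\mathcal{M} I^n$. The depth of $\operatorname{gr}_I(R)$ is the depth with respect to its maximal homogeneous ideal $\mathcal{M}/I \oplus \bigoplus_{n\ge 1} I^n/I^{n+1}$, and the depth of $F(I)$ is the depth with respect to its maximal homogeneous ideal $\bigoplus_{n \geq 1} I^n/\mathcal{M} I^n$. *)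

theory Defs
  imports
    "HOL-Algebra.Ideal_Product"
    "HOL-Algebra.QuotRing"
    "HOL-Algebra.Algebraic_Closure_Type"
    "HOL-Computational_Algebra.Polynomial"
    "HOL-Library.Extended_Nat"
begin

section \<open>Depth\<close>

definition nonzerodivisor :: "('a, 'b) ring_scheme \<Rightarrow> 'a \<Rightarrow> bool" where
  "nonzerodivisor A a \<longleftrightarrow>
     a \<in> carrier A \<and> (\<forall>b\<in>carrier A. a \<otimes>\<^bsub>A\<^esub> b = \<zero>\<^bsub>A\<^esub> \<longrightarrow> b = \<zero>\<^bsub>A\<^esub>)"

definition regular_sequence :: "('a, 'b) ring_scheme \<Rightarrow> 'a list \<Rightarrow> bool" where
  "regular_sequence A as \<longleftrightarrow>
     set as \<subseteq> carrier A \<and> Idl\<^bsub>A\<^esub> (set as) \<noteq> carrier A \<and>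
     (\<forall>i<length as. let J = Idl\<^bsub>A\<^esub> (set (take i as))
        in nonzerodivisor (A Quot J) (J +>\<^bsub>A\<^esub> as ! i))"

definition depth :: "('a, 'b) ring_scheme \<Rightarrow> 'a set \<Rightarrow> enat" where
  "depth A \<mm> = (SUP as \<in> {as. regular_sequence A as \<and> set as \<subseteq> \<mm>}. enat (length as))"


section \<open>Graded rings of ideal powers\<close>

abbreviation ideal_power :: "('a, 'b) ring_scheme \<Rightarrow> 'a set \<Rightarrow> nat \<Rightarrow> 'a set" where
  "ideal_power R I n \<equiv> I [^]\<^bsub>ideals_set R\<^esub> n"

text \<open>
  For families of ideals \<open>B n \<subseteq> A n\<close> of \<open>R\<close> with \<open>A i \<cdot> A j \<subseteq> A (i + j)\<close> and
  \<open>A i \<cdot> B j \<subseteq> B (i + j)\<close>, this is the ring \<open>\<Oplus>\<^sub>n A n / B n\<close>. An element is a finitely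
  supported family of cosets, \<open>A n / B n\<close> being regarded as a subset of \<open>R / B n\<close>;
  the product of \<open>a + B i\<close> and \<open>b + B j\<close> is \<open>a b + B (i + j)\<close>.
\<close>

definition graded_quotient ::
  "('a, 'b) ring_scheme \<Rightarrow> (nat \<Rightarrow> 'a set) \<Rightarrow> (nat \<Rightarrow> 'a set) \<Rightarrow> (nat \<Rightarrow> 'a set) ring" where
  "graded_quotient R A B =
     \<lparr>carrier = {f. (\<forall>n. f n \<in> (\<lambda>a. B n +>\<^bsub>R\<^esub> a) ` A n) \<and> finite {n. f n \<noteq> B n}},
      monoid.mult = (\<lambda>f g n. \<Oplus>\<^bsub>R Quot B n\<^esub>i\<in>{..n}. ([mod B n:] f i \<Otimes>\<^bsub>R\<^esub> g (n - i))),
      one = (\<lambda>n. if n = 0 then B 0 +>\<^bsub>R\<^esub> \<one>\<^bsub>R\<^esub> else B n),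
      zero = B,
      add = (\<lambda>f g n. f n <+>\<^bsub>R\<^esub> g n)\<rparr>"


section \<open>The polynomial ring in two variables\<close>

text \<open>\<open>K[x,y]\<close> is represented as \<open>K[y][x]\<close>: the coefficient of \<open>x\<^sup>i y\<^sup>j\<close> in \<open>f\<close> is
  \<open>coeff (coeff f i) j\<close>.\<close>

abbreviation Kxy :: "'k::field poly poly ring" where
  "Kxy \<equiv> ring_of_type_algebra"

definition var_x :: "'k::field poly poly" where
  "var_x = Polynomial.monom 1 1"

definition var_y :: "'k::field poly poly" where
  "var_y = [:Polynomial.monom 1 1:]"

definition max_ideal :: "'k::field poly poly set" where
  "max_ideal = Idl\<^bsub>Kxy\<^esub> {var_x, var_y}"

definition forms :: "nat \<Rightarrow> 'k::field poly poly set" where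
  "forms e = {f. \<forall>i j. Polynomial.coeff (Polynomial.coeff f i) j \<noteq> 0 \<longrightarrow> i + j = e}"

definition hom_component :: "nat \<Rightarrow> 'k::field poly poly \<Rightarrow> 'k poly poly" where
  "hom_component e f =
     (\<Sum>i\<le>e. Polynomial.smult [:Polynomial.coeff (Polynomial.coeff f i) (e - i):] (var_x ^ i * var_y ^ (e - i)))"

definition graded_ideal :: "'k::field poly poly set \<Rightarrow> bool" where
  "graded_ideal I \<longleftrightarrow> ideal I Kxy \<and> (\<forall>f\<in>I. \<forall>e. hom_component e f \<in> I)"

lemma vector_space_Kxy: "vector_space (\<lambda>c f :: 'k::field poly poly. Polynomial.smult [:c:] f)"
  by unfold_locales (simp_all add: smult_add_right mult.commute flip: smult_add_left one_pCons)

definition K_span :: "'k::field poly poly set \<Rightarrow> 'k poly poly set" where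
  "K_span = module.span (\<lambda>c. Polynomial.smult [:c:])"

definition lex_segment_ideal :: "'k::field poly poly set \<Rightarrow> bool" where
  "lex_segment_ideal I \<longleftrightarrow>
     graded_ideal I \<and> I \<noteq> {0} \<and> I \<noteq> UNIV \<and>
     (\<forall>e. I \<inter> forms e \<noteq> {0} \<longrightarrow>
        (\<exists>j\<le>e. I \<inter> forms e = K_span ((\<lambda>i. var_x ^ (e - i) * var_y ^ i) ` {..j})))"


section \<open>Associated graded ring and fiber cone\<close>

definition assoc_graded_ring :: "'k::field poly poly set \<Rightarrow> (nat \<Rightarrow> 'k poly poly set) ring" where
  "assoc_graded_ring I =
     graded_quotient Kxy (ideal_power Kxy I) (\<lambda>n. ideal_power Kxy I (Suc n))"

text \<open>The degree-zero part of the associated graded ring is \<open>R / I\<close>, so its maximal homogeneous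
  ideal contains only \<open>\<M> / I\<close> in degree zero; for the fiber cone that part is the field \<open>R / \<M>\<close>,
  which does not contribute.\<close>

definition assoc_graded_max :: "'k::field poly poly set \<Rightarrow> (nat \<Rightarrow> 'k poly poly set) set" where
  "assoc_graded_max I =
     {f \<in> carrier (assoc_graded_ring I). f 0 \<in> (\<lambda>a. I +>\<^bsub>Kxy\<^esub> a) ` max_ideal}"

definition fiber_cone :: "'k::field poly poly set \<Rightarrow> (nat \<Rightarrow> 'k poly poly set) ring" where
  "fiber_cone I =
     graded_quotient Kxy (ideal_power Kxy I) (\<lambda>n. max_ideal \<cdot>\<^bsub>Kxy\<^esub> ideal_power Kxy I n)"

definition fiber_cone_max :: "'k::field poly poly set \<Rightarrow> (nat \<Rightarrow> 'k poly poly set) set" where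
  "fiber_cone_max I = {f \<in> carrier (fiber_cone I). f 0 = \<zero>\<^bsub>fiber_cone I\<^esub> 0}"

end

theory Submission
  imports Defs "HOL-Library.Product_Plus" "HOL-Library.Product_Lexorder"
begin

text \<open>
  A lex-segment ideal is monomial, and its set of exponents is stable under
  \<open>x\<^sup>i y\<^sup>j\<^sup>+\<^sup>1 \<mapsto> x\<^sup>i\<^sup>+\<^sup>1 y\<^sup>j\<close>; its powers inherit this. Both graded rings have a basis of
  monomials \<open>(n, u)\<close> in which a product of basis elements is a basis element or zero. In such a ring
  the depth is positive iff no basis element is annihilated by all monomials of positive degree:
  otherwise the sum of the algebra generators is a nonzerodivisor. Indeed, in an annihilated element of
  minimal support all terms are killed by the same generators, and then the product of the largest
  surviving generator and the largest term cannot cancel.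

  Such socle monomials of the two rings correspond to each other: if \<open>u\<close> is one of \<open>F(I)\<close>, then \<open>u / y\<close>
  is one of \<open>gr\<^sub>I(R)\<close> (in the highest degree \<open>m\<close> with \<open>u / y \<in> I\<^sup>m\<close>), and if \<open>v\<close> is one of
  \<open>gr\<^sub>I(R)\<close>, then \<open>v y\<close> is one of \<open>F(I)\<close> in the next degree.
\<close>

section \<open>Depth and nonzerodivisors\<close>

text \<open>The first term of a regular sequence is a nonzerodivisor modulo the zero ideal.
  Conversely, a nonzerodivisor in \<open>M\<close> is by itself a regular sequence, because the
  ideal it generates stays inside the proper ideal \<open>M\<close>.\<close>

lemma depth_pos_iff:
  assumes "ring A" "ideal M A" "M \<noteq> carrier A"
  shows "depth A M > 0 \<longleftrightarrow> (\<exists>a\<in>M. nonzerodivisor A a)"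
proof -
  interpret ring A by fact
  interpret M: ideal M A by fact
  interpret Z: ideal "{\<zero>\<^bsub>A\<^esub>}" A by (rule zeroideal)
  have Idl_empty: "Idl\<^bsub>A\<^esub> {} = {\<zero>\<^bsub>A\<^esub>}"
    using genideal_minimal[OF zeroideal, of "{}"] genideal_ideal[of "{}"]
    by (auto simp: additive_subgroup.zero_closed ideal.axioms(1))
  \<comment> \<open>The quotient by the zero ideal is not \<open>A\<close> itself but its copy under
    \<open>a \<mapsto> {a}\<close>; the following facts transport products and nonzerodivisors along
    this identification.\<close>
  have coset: "{\<zero>\<^bsub>A\<^esub>} +>\<^bsub>A\<^esub> a = {a}" if "a \<in> carrier A" for a
    using that by (auto simp: a_r_coset_def')
  have mult: "{a} \<otimes>\<^bsub>A Quot {\<zero>\<^bsub>A\<^esub>}\<^esub> {b} = {a \<otimes>\<^bsub>A\<^esub> b}" if "a \<in> carrier A" "b \<in> carrier A" for a b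
    using Z.rcoset_mult_add[OF that] that by (simp add: coset FactRing_def)
  have carrier: "carrier (A Quot {\<zero>\<^bsub>A\<^esub>}) = (\<lambda>a. {a}) ` carrier A"
    using coset by (auto simp: FactRing_def A_RCOSETS_def')
  have zero: "\<zero>\<^bsub>A Quot {\<zero>\<^bsub>A\<^esub>}\<^esub> = {\<zero>\<^bsub>A\<^esub>}"
    by (simp add: FactRing_def)
  have nzd: "nonzerodivisor (A Quot {\<zero>\<^bsub>A\<^esub>}) {a} \<longleftrightarrow> nonzerodivisor A a" if "a \<in> carrier A" for a
    using that by (auto simp: nonzerodivisor_def carrier zero mult)
  show ?thesis
  proof
    assume "depth A M > 0"
    then obtain as where as: "regular_sequence A as" "set as \<subseteq> M" "as \<noteq> []"
      by (auto simp: depth_def less_SUP_iff zero_enat_def)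
    then have "as ! 0 \<in> M"
      by (simp add: nth_mem subset_eq)
    moreover have "nonzerodivisor (A Quot {\<zero>\<^bsub>A\<^esub>}) ({\<zero>\<^bsub>A\<^esub>} +>\<^bsub>A\<^esub> as ! 0)"
      using as(1,3) unfolding regular_sequence_def Let_def
      by (metis Idl_empty length_greater_0_conv list.set(1) take_0)
    ultimately show "\<exists>a\<in>M. nonzerodivisor A a"
      using nzd coset M.a_subset by (metis subset_eq)
  next
    assume "\<exists>a\<in>M. nonzerodivisor A a"
    then obtain a where a: "a \<in> M" "nonzerodivisor A a" by blast
    have "Idl\<^bsub>A\<^esub> {a} \<subseteq> M"
      using a(1) by (intro genideal_minimal assms) auto
    then have "regular_sequence A [a]"
      using a assms(3) M.a_subset
      by (auto simp: regular_sequence_def Idl_empty coset nzd Let_def)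
    then show "depth A M > 0"
      using a(1) unfolding depth_def less_SUP_iff by (intro bexI[of _ "[a]"]) (auto simp: zero_enat_def)
  qed
qed

section \<open>Monomial ideals\<close>

lemma Kxy_simps [simp]:
  "carrier ring_of_type_algebra = UNIV"
  "\<one>\<^bsub>ring_of_type_algebra\<^esub> = 1" "\<zero>\<^bsub>ring_of_type_algebra\<^esub> = 0"
  "x \<otimes>\<^bsub>ring_of_type_algebra\<^esub> y = x * y" "x \<oplus>\<^bsub>ring_of_type_algebra\<^esub> y = x + y"
  by (simp_all add: ring_of_type_algebra_def)

lemma a_r_coset_type_algebra: "J +>\<^bsub>ring_of_type_algebra\<^esub> x = (\<lambda>h. h + x) ` J"
  by (auto simp: a_r_coset_def')

abbreviation coeff_xy :: "'k::zero poly poly \<Rightarrow> nat \<Rightarrow> nat \<Rightarrow> 'k" where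
  "coeff_xy f i j \<equiv> Polynomial.coeff (Polynomial.coeff f i) j"

text \<open>The \<open>K\<close>-span of the monomials with exponent in \<open>U\<close>, given by a
  condition on supports so that membership is checked coefficientwise. It is an ideal once
  \<open>U\<close> is stable under adding arbitrary exponents.\<close>

definition mono_ideal :: "(nat \<times> nat) set \<Rightarrow> 'k::field poly poly set" where
  "mono_ideal U = {f. \<forall>i j. coeff_xy f i j \<noteq> 0 \<longrightarrow> (i, j) \<in> U}"

lemma mono_ideal_mono: "U \<subseteq> V \<Longrightarrow> mono_ideal U \<subseteq> mono_ideal V"
  by (auto simp: mono_ideal_def)

lemma mono_ideal_zero [simp]: "0 \<in> mono_ideal U"
  by (simp add: mono_ideal_def)

lemma mono_ideal_add: "f \<in> mono_ideal U \<Longrightarrow> g \<in> mono_ideal U \<Longrightarrow> f + g \<in> mono_ideal U"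
  unfolding mono_ideal_def by (auto, metis add_0)

lemma mono_ideal_uminus: "f \<in> mono_ideal U \<Longrightarrow> - f \<in> mono_ideal U"
  by (simp add: mono_ideal_def)

lemma mono_ideal_diff: "f \<in> mono_ideal U \<Longrightarrow> g \<in> mono_ideal U \<Longrightarrow> f - g \<in> mono_ideal U"
  using mono_ideal_add[OF _ mono_ideal_uminus, of f U g] by simp

lemma mono_ideal_sum: "(\<And>x. x \<in> A \<Longrightarrow> f x \<in> mono_ideal U) \<Longrightarrow> sum f A \<in> mono_ideal U"
  by (induction A rule: infinite_finite_induct) (auto intro: mono_ideal_add)

lemma coeff_mult_xy:
  "coeff_xy (f * g) i j =
    (\<Sum>a\<le>i. \<Sum>b\<le>j. coeff_xy f a b * coeff_xy g (i - a) (j - b))"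
  by (simp add: coeff_mult Polynomial.coeff_sum)

lemma mono_ideal_mult:
  assumes "f \<in> mono_ideal U" "g \<in> mono_ideal V"
    and "\<And>u v. u \<in> U \<Longrightarrow> v \<in> V \<Longrightarrow> u + v \<in> W"
  shows "f * g \<in> mono_ideal W"
  unfolding mono_ideal_def
proof (intro CollectI allI impI)
  fix i j assume "coeff_xy (f * g) i j \<noteq> 0"
  then obtain a b where *: "a \<le> i" "b \<le> j" "coeff_xy f a b * coeff_xy g (i - a) (j - b) \<noteq> 0"
    unfolding coeff_mult_xy by (metis (mono_tags, lifting) atMost_iff sum.neutral)
  then have "(a, b) \<in> U" "(i - a, j - b) \<in> V"
    using assms(1,2) by (auto simp: mono_ideal_def)
  from assms(3)[OF this] show "(i, j) \<in> W" using * by simp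
qed

lemma ideal_mono_ideal:
  assumes "\<And>u v. u \<in> U \<Longrightarrow> u + v \<in> U"
  shows "ideal (mono_ideal U) (Kxy :: 'k::field poly poly ring)"
proof -
  interpret cring "Kxy :: 'k poly poly ring" by (rule cring_from_type_algebra)
  have assms': "v + u \<in> U" if "u \<in> U" for u v
    using assms[OF that, of v] by (simp add: add.commute)
  have "subgroup (mono_ideal U) (add_monoid (Kxy :: 'k poly poly ring))"
  proof (rule add.subgroupI)
    fix f :: "'k poly poly" assume "f \<in> mono_ideal U"
    moreover have "\<ominus>\<^bsub>Kxy\<^esub> f = - f"
      by (rule minus_equality) simp_all
    ultimately show "\<ominus>\<^bsub>Kxy\<^esub> f \<in> mono_ideal U" by (simp add: mono_ideal_uminus)
  next
    show "(mono_ideal U :: 'k poly poly set) \<noteq> {}"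
      using mono_ideal_zero by blast
  qed (auto intro: mono_ideal_add)
  then show ?thesis
  proof (rule idealI[OF ring_axioms], goal_cases)
    case (1 a x)
    then show ?case
      using mono_ideal_mult[of x UNIV a U U] assms' by (simp add: mono_ideal_def)
  next
    case (2 a x)
    then show ?case
      using mono_ideal_mult[of a U x UNIV U] assms by (simp add: mono_ideal_def)
  qed
qed

lemma mono_ideal_monom: "Polynomial.monom (Polynomial.monom c j) i \<in> mono_ideal U \<longleftrightarrow> c = 0 \<or> (i, j) \<in> U"
  by (auto simp: mono_ideal_def)

lemma monom_sum: "Polynomial.monom (sum g A) i = (\<Sum>a\<in>A. Polynomial.monom (g a) i)"
  by (induction A rule: infinite_finite_induct) (simp_all flip: Polynomial.add_monom)

lemma poly_poly_eq_sum_monom: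
  "f = (\<Sum>i\<le>Polynomial.degree f. \<Sum>j\<le>Polynomial.degree (Polynomial.coeff f i).
          Polynomial.monom (Polynomial.monom (coeff_xy f i j) j) i)"
  by (simp add: poly_as_sum_of_monoms flip: monom_sum)

text \<open>A polynomial is the finite sum of its terms, so an additive property need only be
  checked on single terms.\<close>

lemma mono_ideal_induct [consumes 1, case_names zero add monom]:
  assumes "f \<in> mono_ideal U" and "P 0" and "\<And>g h. P g \<Longrightarrow> P h \<Longrightarrow> P (g + h)"
    and "\<And>c i j. (i, j) \<in> U \<Longrightarrow> P (Polynomial.monom (Polynomial.monom c j) i)"
  shows "P f"
proof -
  have sum: "P (sum g A)" if "\<And>a. a \<in> A \<Longrightarrow> P (g a)" for g and A :: "nat set"
    using that by (induction A rule: infinite_finite_induct) (auto intro: assms)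
  \<comment> \<open>The sum of terms runs over all positions up to the degrees; those with
    coefficient zero may have exponents outside \<open>U\<close> and fall under
    \<open>P 0\<close>.\<close>
  have "P (Polynomial.monom (Polynomial.monom (coeff_xy f i j) j) i)" for i j
    using assms by (cases "coeff_xy f i j = 0") (auto simp: mono_ideal_def)
  then show ?thesis
    by (subst poly_poly_eq_sum_monom) (intro sum)
qed

section \<open>Products and powers of monomial ideals\<close>

definition sumset :: "'a::plus set \<Rightarrow> 'a set \<Rightarrow> 'a set" where
  "sumset U V = {u + v |u v. u \<in> U \<and> v \<in> V}"

lemma sumsetI: "u \<in> U \<Longrightarrow> v \<in> V \<Longrightarrow> u + v \<in> sumset U V"
  by (auto simp: sumset_def)

text \<open>A term with exponent \<open>u + v\<close> factors into a term with exponent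
  \<open>u\<close>, carrying the coefficient, and a monomial with exponent \<open>v\<close>.\<close>

lemma ideal_prod_mono_ideal:
  "mono_ideal U \<cdot>\<^bsub>Kxy\<^esub> mono_ideal V = (mono_ideal (sumset U V) :: 'k::field poly poly set)"
proof (intro equalityI subsetI)
  fix f :: "'k poly poly" assume "f \<in> mono_ideal U \<cdot>\<^bsub>Kxy\<^esub> mono_ideal V"
  then show "f \<in> mono_ideal (sumset U V)"
    by induction (auto intro: mono_ideal_mult mono_ideal_add sumsetI)
next
  fix f :: "'k poly poly" assume "f \<in> mono_ideal (sumset U V)"
  then show "f \<in> mono_ideal U \<cdot>\<^bsub>Kxy\<^esub> mono_ideal V"
  proof (induction rule: mono_ideal_induct)
    case zero
    show ?case
      using ideal_prod.prod[of 0 "mono_ideal U" 0 "mono_ideal V" Kxy] by simp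
  next
    case (add g h)
    then show ?case
      using ideal_prod.sum[of g Kxy _ _ h] by simp
  next
    case (monom c i j)
    then obtain a b a' b' where "(a, b) \<in> U" "(a', b') \<in> V" "i = a + a'" "j = b + b'"
      by (auto simp: sumset_def)
    then show ?case
      using ideal_prod.prod[of "Polynomial.monom (Polynomial.monom c b) a" "mono_ideal U"
          "Polynomial.monom (Polynomial.monom 1 b') a'" "mono_ideal V" Kxy]
      by (simp add: mono_ideal_monom mult_monom)
  qed
qed

text \<open>The recursion starts at \<open>UNIV\<close> rather than \<open>{0}\<close> because the
  zeroth power of an ideal is the whole ring.\<close>

primrec sumset_power :: "'a::plus set \<Rightarrow> nat \<Rightarrow> 'a set" where
  "sumset_power U 0 = UNIV"
| "sumset_power U (Suc n) = sumset (sumset_power U n) U"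

lemma ideal_power_mono_ideal:
  "ideal_power Kxy (mono_ideal U) n = (mono_ideal (sumset_power U n) :: 'k::field poly poly set)"
proof (induction n)
  case 0
  show ?case by (simp add: nat_pow_def ideals_set_def mono_ideal_def)
next
  case (Suc n)
  then show ?case by (simp add: nat_pow_def ideals_set_def flip: ideal_prod_mono_ideal)
qed

section \<open>Graded quotients of monomial families\<close>

type_synonym exponent = "nat \<times> nat \<times> nat"

text \<open>The exponent of \<open>t\<^sup>n x\<^sup>i y\<^sup>j\<close> is \<open>(n, i, j)\<close>, where \<open>t\<close> is the outermost variable, marking the
  degree of the Rees algebra.\<close>

definition coeff_txy :: "'k::zero poly poly poly \<Rightarrow> exponent \<Rightarrow> 'k" where
  "coeff_txy P e = coeff_xy (Polynomial.coeff P (fst e)) (fst (snd e)) (snd (snd e))"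

definition monomial :: "exponent \<Rightarrow> 'k::field poly poly poly" where
  "monomial e = Polynomial.monom (Polynomial.monom (Polynomial.monom 1 (snd (snd e))) (fst (snd e))) (fst e)"

definition supported_on :: "exponent set \<Rightarrow> 'k::field poly poly poly set" where
  "supported_on N = {P. \<forall>e. coeff_txy P e \<noteq> 0 \<longrightarrow> e \<in> N}"

lemma coeff_txy_add: "coeff_txy (P + Q) e = coeff_txy P e + coeff_txy Q e"
  and coeff_txy_diff: "coeff_txy (P - P') e = coeff_txy P e - coeff_txy (P' :: 'k::field poly poly poly) e"
  and coeff_txy_uminus: "coeff_txy (- P') e = - coeff_txy P' e"
  and coeff_txy_sum: "coeff_txy (sum h A) e = (\<Sum>a\<in>A. coeff_txy (h a) e)"
  and coeff_txy_zero [simp]: "coeff_txy 0 e = 0"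
  by (simp_all add: coeff_txy_def Polynomial.coeff_sum)

lemma coeff_txy_one: "coeff_txy 1 e = (if e = 0 then 1 else 0)"
  by (cases e) (auto simp: coeff_txy_def zero_prod_def)

lemma coeff_txy_monomial: "coeff_txy (monomial g) e = (if e = g then 1 else 0)"
  by (cases e; cases g) (auto simp: coeff_txy_def monomial_def)

lemma coeff_txy_mult_zero: "coeff_txy (P * Q) 0 = coeff_txy P 0 * coeff_txy Q 0"
  by (simp add: coeff_txy_def zero_prod_def coeff_mult_0)

lemma coeff_txy_monomial_mult: "coeff_txy (monomial g * P) (g + e) = coeff_txy P e"
  by (simp add: coeff_txy_def monomial_def coeff_monom_mult)

lemma coeff_txy_monomial_mult_nonzero:
  assumes "coeff_txy (monomial g * P) e \<noteq> 0"
  obtains e' where "e = g + e'" "coeff_txy P e' \<noteq> 0"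
proof
  \<comment> \<open>Truncated subtraction is exact here: a nonzero coefficient of the product forces
    \<open>e\<close> to dominate \<open>g\<close> in every component.\<close>
  show "e = g + (fst e - fst g, fst (snd e) - fst (snd g), snd (snd e) - snd (snd g))"
    using assms by (cases e; cases g) (auto simp: coeff_txy_def monomial_def coeff_monom_mult split: if_splits)
  then show "coeff_txy P (fst e - fst g, fst (snd e) - fst (snd g), snd (snd e) - snd (snd g)) \<noteq> 0"
    using assms coeff_txy_monomial_mult by metis
qed

lemma supported_onD: "P \<in> supported_on U \<Longrightarrow> coeff_txy P e \<noteq> 0 \<Longrightarrow> e \<in> U"
  unfolding supported_on_def by blast

lemma monomial_in_supported_on_iff: "monomial e \<in> supported_on U \<longleftrightarrow> e \<in> U"
  by (simp add: supported_on_def coeff_txy_monomial del: split_paired_All)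

lemma monomial_mult_supported_on:
  assumes "P \<in> supported_on U" "\<And>e. e \<in> U \<Longrightarrow> g + e \<in> V"
  shows "monomial g * P \<in> supported_on V"
  unfolding supported_on_def
  by (auto simp del: split_paired_All elim!: coeff_txy_monomial_mult_nonzero
      intro!: assms(2) supported_onD[OF assms(1)])

lemma finite_support: "finite {e. coeff_txy P e \<noteq> 0}"
proof (rule finite_subset)
  show "{e. coeff_txy P e \<noteq> 0} \<subseteq>
      (SIGMA n:{..Polynomial.degree P}. SIGMA i:{..Polynomial.degree (Polynomial.coeff P n)}.
        {..Polynomial.degree (Polynomial.coeff (Polynomial.coeff P n) i)})"
    by (auto simp: coeff_txy_def intro!: le_degree)
qed auto

section \<open>A sum of monomials as nonzerodivisor\<close>

lemma add_strict_mono_exponent: "g < g' \<Longrightarrow> e \<le> e' \<Longrightarrow> g + e < g' + (e' :: exponent)"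
  by (cases g; cases g'; cases e; cases e') auto

text \<open>The product of the largest generator and the largest term may fall into
  \<open>N\<close>, so comparing leading terms is not enough. In a counterexample with fewest terms
  outside \<open>N\<close>, each generator moves either all or none of these terms into
  \<open>N\<close>. The largest generator that does not do so then yields, with the largest term, a
  product that nothing cancels; the lexicographic order is compatible with addition.\<close>

lemma sum_monomials_nonzerodivisor:
  fixes P :: "'k::field poly poly poly"
  assumes "N \<subseteq> Y" and YY: "\<And>a b. a \<in> Y \<Longrightarrow> b \<in> Y \<Longrightarrow> a + b \<in> Y"
    and YX: "\<And>a b. a \<in> Y \<Longrightarrow> b \<in> N \<Longrightarrow> a + b \<in> N"
    and G: "finite G" "G \<subseteq> Y" and nosocle: "\<And>e. e \<in> Y - N \<Longrightarrow> \<exists>g\<in>G. g + e \<notin> N"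
    and P: "P \<in> supported_on Y" "(\<Sum>g\<in>G. monomial g) * P \<in> supported_on N"
  shows "P \<in> supported_on N"
proof (rule ccontr)
  define \<theta> :: "'k poly poly poly" where "\<theta> = (\<Sum>g\<in>G. monomial g)"
  define supp where "supp = (\<lambda>Q :: 'k poly poly poly. {e \<in> Y - N. coeff_txy Q e \<noteq> 0})"
  define bad where "bad = (\<lambda>Q. Q \<in> supported_on Y \<and> \<theta> * Q \<in> supported_on N \<and> supp Q \<noteq> {})"
  have fin: "finite (supp Q)" for Q
    by (rule finite_subset[OF _ finite_support[of Q]]) (auto simp: supp_def)
  assume "P \<notin> supported_on N"
  with P have "bad P"
    unfolding bad_def \<theta>_def supp_def supported_on_def by blast
  then obtain Q where Q: "bad Q" and min: "\<And>Q'. bad Q' \<Longrightarrow> card (supp Q) \<le> card (supp Q')"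
    using ex_has_least_nat[of bad P "\<lambda>Q. card (supp Q)"] by blast
  have QY: "Q \<in> supported_on Y" and \<theta>Q: "\<theta> * Q \<in> supported_on N"
    using Q by (auto simp: bad_def)
  \<comment> \<open>\<open>N\<close> absorbs addition of elements of \<open>Y\<close>, so a term
    that survives multiplication by some \<open>g\<close> was already outside
    \<open>N\<close>.\<close>
  have in_supp: "e \<in> supp Q" if "coeff_txy Q e \<noteq> 0" "g \<in> G" "g + e \<notin> N" for g e
    using that QY G(2) YX unfolding supp_def supported_on_def by blast
  \<comment> \<open>If \<open>g\<close> kills the term at \<open>e'\<close> but not the one at
    \<open>e\<close>, then \<open>monomial g * Q\<close> is again a counterexample, with fewer terms
    outside \<open>N\<close>.\<close>
  have uniform: "g + e' \<notin> N" if g: "g \<in> G" and e: "e \<in> supp Q" "g + e \<notin> N" and e': "e' \<in> supp Q" for g e e'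
  proof
    assume "g + e' \<in> N"
    have sub: "supp (monomial g * Q) \<subseteq> (+) g ` (supp Q - {e'})"
    proof
      fix a assume a: "a \<in> supp (monomial g * Q)"
      then have "coeff_txy (monomial g * Q) a \<noteq> 0" "a \<notin> N"
        by (auto simp: supp_def)
      from this(1) obtain b where b: "a = g + b" "coeff_txy Q b \<noteq> 0"
        by (rule coeff_txy_monomial_mult_nonzero)
      then have "b \<in> supp Q" "b \<noteq> e'"
        using in_supp[OF _ g] \<open>a \<notin> N\<close> \<open>g + e' \<in> N\<close> by auto
      then show "a \<in> (+) g ` (supp Q - {e'})"
        using b(1) by blast
    qed
    have "monomial g * Q \<in> supported_on Y"
      using QY g G(2) YY by (intro monomial_mult_supported_on) blast+
    moreover have "monomial g * (\<theta> * Q) \<in> supported_on N"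
      using \<theta>Q g G(2) YX by (intro monomial_mult_supported_on) blast+
    moreover have "g + e \<in> supp (monomial g * Q)"
      using e g G(2) YY[of g e] by (auto simp: supp_def coeff_txy_monomial_mult)
    ultimately have "bad (monomial g * Q)"
      unfolding bad_def mult.left_commute[of \<theta> "monomial g"] by blast
    then have "card (supp Q) \<le> card (supp (monomial g * Q))" by (rule min)
    also have "\<dots> \<le> card (supp Q - {e'})"
      using fin by (intro surj_card_le[OF _ sub]) simp
    also have "\<dots> < card (supp Q)"
      by (rule card_Diff1_less[OF fin e'])
    finally show False by simp
  qed
  define e where "e = Max (supp Q)"
  have e: "e \<in> supp Q" and e_max: "\<And>e'. e' \<in> supp Q \<Longrightarrow> e' \<le> e"
    using Q Max_in[OF fin, of Q] Max_ge[OF fin, of _ Q] unfolding e_def bad_def by blast+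
  define W where "W = {g \<in> G. g + e \<notin> N}"
  define g where "g = Max W"
  have "W \<noteq> {}" "finite W"
    using nosocle[of e] e G by (auto simp: W_def supp_def)
  then have g: "g \<in> G" "g + e \<notin> N" and g_max: "\<And>g'. g' \<in> W \<Longrightarrow> g' \<le> g"
    using Max_in[of W] by (auto simp: g_def W_def)
  have "coeff_txy (monomial g' * Q) (g + e) = 0" if g': "g' \<in> G" "g' \<noteq> g" for g'
  proof (rule ccontr)
    assume "coeff_txy (monomial g' * Q) (g + e) \<noteq> 0"
    then obtain e' where e': "g + e = g' + e'" "coeff_txy Q e' \<noteq> 0"
      by (rule coeff_txy_monomial_mult_nonzero)
    then have "e' \<in> supp Q"
      using in_supp[of e' g'] g(2) g'(1) by simp
    \<comment> \<open>Survival of \<open>g'\<close> on \<open>e'\<close> carries over to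
      \<open>e\<close> by uniformity, so the maximality of \<open>g\<close> applies to
      \<open>g'\<close>.\<close>
    moreover from this have "g' \<in> W"
      using uniform[OF g'(1) _ _ e, of e'] e'(1) g(2) g'(1) by (simp add: W_def)
    ultimately have "g' < g" "e' \<le> e"
      using g_max[of g'] e_max[of e'] g'(2) by (simp_all del: less_eq_prod_simp less_prod_simp)
    then have "g' + e' < g + e" by (rule add_strict_mono_exponent)
    with e'(1) show False by simp
  qed
  then have "coeff_txy (\<theta> * Q) (g + e) = coeff_txy (monomial g * Q) (g + e)"
    using sum.remove[OF G(1) g(1), of "\<lambda>g'. coeff_txy (monomial g' * Q) (g + e)"]
    by (simp add: \<theta>_def sum_distrib_right coeff_txy_sum)
  then show False
    using supported_onD[OF \<theta>Q, of "g + e"] e g(2) by (simp add: supp_def coeff_txy_monomial_mult)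
qed

text \<open>Common frame for both rings: \<open>S n\<close> holds the exponents of
  \<open>I^n\<close>, while \<open>T n\<close> holds those of \<open>I^(n+1)\<close> for the
  associated graded ring and those of \<open>\<M> I^n\<close> for the fiber cone.\<close>

locale monomial_quotient =
  fixes S T :: "nat \<Rightarrow> (nat \<times> nat) set"
  assumes T_subset: "T n \<subseteq> S n"
    and S_0: "S 0 = UNIV" and zero_notin_T: "0 \<notin> T 0"
    and S_add_S: "u \<in> S m \<Longrightarrow> v \<in> S n \<Longrightarrow> u + v \<in> S (m + n)"
    and S_add_T: "u \<in> S m \<Longrightarrow> v \<in> T n \<Longrightarrow> u + v \<in> T (m + n)"
begin

abbreviation Q :: "(nat \<Rightarrow> 'k::field poly poly set) ring" where
  "Q \<equiv> graded_quotient Kxy (\<lambda>n. mono_ideal (S n)) (\<lambda>n. mono_ideal (T n))"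

definition exps :: "(nat \<Rightarrow> (nat \<times> nat) set) \<Rightarrow> exponent set" where
  "exps U = {e. snd e \<in> U (fst e)}"

text \<open>The quotient map from the Rees algebra of the family \<open>S\<close>, seen inside
  \<open>K[x,y][t]\<close>, onto \<open>Q\<close>. It is total, but represents ring elements on
  polynomials supported on \<open>exps S\<close>.\<close>

definition cls :: "'k::field poly poly poly \<Rightarrow> nat \<Rightarrow> 'k poly poly set" where
  "cls P n = mono_ideal (T n) +>\<^bsub>Kxy\<^esub> Polynomial.coeff P n"

lemma supported_on_exps: "P \<in> supported_on (exps U) \<longleftrightarrow> (\<forall>n. Polynomial.coeff P n \<in> mono_ideal (U n))"
  by (auto simp: supported_on_def exps_def mono_ideal_def coeff_txy_def)

lemma exps_add: "g \<in> exps S \<Longrightarrow> e \<in> exps S \<Longrightarrow> g + e \<in> exps S"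
  using S_add_S by (simp add: exps_def)

lemma exps_add_T: "g \<in> exps S \<Longrightarrow> e \<in> exps T \<Longrightarrow> g + e \<in> exps T"
  using S_add_T by (simp add: exps_def)

lemma exps_T_subset: "exps T \<subseteq> exps S"
  using T_subset by (auto simp: exps_def)

text \<open>As \<open>S 0 = UNIV\<close>, the rule \<open>S_add_T\<close> in degree \<open>0\<close>
  makes \<open>T n\<close> stable under adding any exponent.\<close>

lemma ideal_T: "ideal (mono_ideal (T n)) (Kxy :: 'k::field poly poly ring)"
  by (intro ideal_mono_ideal) (metis S_0 S_add_T UNIV_I add.commute add_0)

lemma coset_eq_iff:
  "mono_ideal (T n) +>\<^bsub>Kxy\<^esub> f = mono_ideal (T n) +>\<^bsub>Kxy\<^esub> g \<longleftrightarrow> f - g \<in> (mono_ideal (T n) :: 'k::field poly poly set)"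
proof
  assume eq: "mono_ideal (T n) +>\<^bsub>Kxy\<^esub> f = mono_ideal (T n) +>\<^bsub>Kxy\<^esub> g"
  have "f \<in> mono_ideal (T n) +>\<^bsub>Kxy\<^esub> f"
    by (auto simp: a_r_coset_type_algebra intro: image_eqI[of _ _ 0])
  then show "f - g \<in> mono_ideal (T n)"
    unfolding eq by (auto simp: a_r_coset_type_algebra)
next
  assume d: "f - g \<in> mono_ideal (T n)"
  have "h + f \<in> (\<lambda>h. h + g) ` mono_ideal (T n)" if "h \<in> mono_ideal (T n)" for h
    using mono_ideal_add[OF that d] by (intro image_eqI[of _ _ "h + (f - g)"]) auto
  moreover have "h + g \<in> (\<lambda>h. h + f) ` mono_ideal (T n)" if "h \<in> mono_ideal (T n)" for h
    using mono_ideal_diff[OF that d] by (intro image_eqI[of _ _ "h - (f - g)"]) auto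
  ultimately show "mono_ideal (T n) +>\<^bsub>Kxy\<^esub> f = mono_ideal (T n) +>\<^bsub>Kxy\<^esub> g"
    by (auto simp: a_r_coset_type_algebra)
qed

lemma cls_eq_iff: "cls P = cls P' \<longleftrightarrow> P - P' \<in> supported_on (exps T)"
  by (simp add: cls_def fun_eq_iff coset_eq_iff supported_on_exps)

lemma zero_eq_cls: "\<zero>\<^bsub>Q\<^esub> = cls 0"
  by (simp add: graded_quotient_def cls_def fun_eq_iff a_r_coset_type_algebra)

lemma one_eq_cls: "\<one>\<^bsub>Q\<^esub> = cls 1"
  by (auto simp: graded_quotient_def cls_def fun_eq_iff a_r_coset_type_algebra)

lemma cls_add:
  fixes P P' :: "'k::field poly poly poly"
  shows "cls P \<oplus>\<^bsub>Q\<^esub> cls P' = cls (P + P')"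
proof -
  have "mono_ideal (T n) +>\<^bsub>Kxy\<^esub> f <+>\<^bsub>Kxy\<^esub> (mono_ideal (T n) +>\<^bsub>Kxy\<^esub> g) = mono_ideal (T n) +>\<^bsub>Kxy\<^esub> (f + g)" for n and f g :: "'k poly poly"
    using ring_hom_add[OF ideal.rcos_ring_hom[OF ideal_T, of n], of f g] by (simp add: FactRing_def)
  then show ?thesis
    by (simp add: graded_quotient_def cls_def fun_eq_iff)
qed

text \<open>The factors are cosets of different ideals, and their product is a union of cosets over
  all representatives \<open>(a + f) * (b + g)\<close>. Every cross term involving \<open>a\<close>
  or \<open>b\<close> is supported on \<open>T (m + n)\<close>, so the cosets in the union
  coincide.\<close>

lemma rcoset_mult_cosets:
  fixes f g :: "'k::field poly poly"
  assumes "f \<in> mono_ideal (S m)" "g \<in> mono_ideal (S n)"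
  shows "[mod mono_ideal (T (m + n)):] (mono_ideal (T m) +>\<^bsub>Kxy\<^esub> f) \<Otimes>\<^bsub>Kxy\<^esub> (mono_ideal (T n) +>\<^bsub>Kxy\<^esub> g)
    = mono_ideal (T (m + n)) +>\<^bsub>Kxy\<^esub> (f * g)"
proof -
  have "mono_ideal (T (m + n)) +>\<^bsub>Kxy\<^esub> ((a + f) * (b + g)) = mono_ideal (T (m + n)) +>\<^bsub>Kxy\<^esub> (f * g)"
    if a: "a \<in> mono_ideal (T m)" and b: "b \<in> mono_ideal (T n)" for a b
  proof -
    have "a * (b + g) \<in> mono_ideal (T (m + n))"
    proof (rule mono_ideal_mult)
      show "b + g \<in> mono_ideal (S n)"
        using b assms(2) mono_ideal_mono[OF T_subset[of n]] by (intro mono_ideal_add) auto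
      show "u + v \<in> T (m + n)" if "u \<in> T m" "v \<in> S n" for u v
        using S_add_T[OF that(2,1)] by (simp add: add.commute)
    qed (rule a)
    moreover have "f * b \<in> mono_ideal (T (m + n))"
      using assms(1) b S_add_T by (intro mono_ideal_mult[of _ "S m" _ "T n"])
    ultimately have "a * (b + g) + f * b \<in> mono_ideal (T (m + n))"
      by (rule mono_ideal_add)
    then show ?thesis
      by (simp add: coset_eq_iff algebra_simps)
  qed
  \<comment> \<open>Without a representative of each factor the union of cosets would be
    empty.\<close>
  moreover have "(mono_ideal (T m) :: 'k poly poly set) \<noteq> {}" "(mono_ideal (T n) :: 'k poly poly set) \<noteq> {}"
    using mono_ideal_zero by blast+
  ultimately show ?thesis
    by (simp add: rcoset_mult_def a_r_coset_type_algebra[of "mono_ideal (T m)"] a_r_coset_type_algebra[of "mono_ideal (T n)"])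
qed

text \<open>In degree \<open>n\<close>, reduction modulo \<open>T n\<close> is a ring homomorphism,
  so the sum may be formed before passing to cosets, where it is the Cauchy product of the
  coefficients.\<close>

lemma cls_mult:
  fixes P P' :: "'k::field poly poly poly"
  assumes "P \<in> supported_on (exps S)" "P' \<in> supported_on (exps S)"
  shows "cls P \<otimes>\<^bsub>Q\<^esub> cls P' = cls (P * P')"
proof
  fix n
  let ?J = "mono_ideal (T n) :: 'k poly poly set"
  interpret J: ideal ?J Kxy by (rule ideal_T)
  interpret hom: ring_hom_ring Kxy "Kxy Quot ?J" "(+>\<^bsub>Kxy\<^esub>) ?J" by (rule J.rcos_ring_hom_ring)
  have coset_mult: "[mod ?J:] cls P i \<Otimes>\<^bsub>Kxy\<^esub> cls P' (n - i)
      = ?J +>\<^bsub>Kxy\<^esub> (Polynomial.coeff P i * Polynomial.coeff P' (n - i))" if "i \<le> n" for i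
    using rcoset_mult_cosets[of "Polynomial.coeff P i" i "Polynomial.coeff P' (n - i)" "n - i"] assms that
    by (simp add: cls_def supported_on_exps)
  have finsum: "(\<Oplus>\<^bsub>Kxy\<^esub>i\<in>A. f i) = sum f A" for A :: "nat set" and f :: "nat \<Rightarrow> 'k poly poly"
    by (induction A rule: infinite_finite_induct) (simp_all add: J.finsum_infinite)
  have "(cls P \<otimes>\<^bsub>Q\<^esub> cls P') n = (\<Oplus>\<^bsub>Kxy Quot ?J\<^esub>i\<in>{..n}. [mod ?J:] cls P i \<Otimes>\<^bsub>Kxy\<^esub> cls P' (n - i))"
    by (simp add: graded_quotient_def)
  also have "\<dots> = (\<Oplus>\<^bsub>Kxy Quot ?J\<^esub>i\<in>{..n}. ?J +>\<^bsub>Kxy\<^esub> (Polynomial.coeff P i * Polynomial.coeff P' (n - i)))"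
    using hom.hom_closed by (intro hom.S.finsum_cong') (auto simp: coset_mult)
  also have "\<dots> = ?J +>\<^bsub>Kxy\<^esub> (\<Oplus>\<^bsub>Kxy\<^esub>i\<in>{..n}. Polynomial.coeff P i * Polynomial.coeff P' (n - i))"
    by (subst hom.hom_finsum) (auto simp: o_def)
  also have "\<dots> = cls (P * P') n"
    by (simp add: finsum cls_def coeff_mult)
  finally show "(cls P \<otimes>\<^bsub>Q\<^esub> cls P') n = cls (P * P') n" .
qed

lemma carrier_eq: "carrier Q = cls ` (supported_on (exps S) :: 'k::field poly poly poly set)"
proof (intro equalityI subsetI)
  fix F :: "nat \<Rightarrow> 'k poly poly set" assume F: "F \<in> carrier Q"
  define N where "N = {n. F n \<noteq> mono_ideal (T n)}"
  have fin: "finite N"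
    and "\<forall>n. \<exists>a. a \<in> mono_ideal (S n) \<and> F n = mono_ideal (T n) +>\<^bsub>Kxy\<^esub> a"
    using F by (auto simp: graded_quotient_def N_def)
  then obtain a where a: "\<And>n. a n \<in> mono_ideal (S n)" "\<And>n. F n = mono_ideal (T n) +>\<^bsub>Kxy\<^esub> a n"
    by metis
  \<comment> \<open>Representatives are kept only in the finitely many degrees with a nonzero class,
    which makes the family a polynomial in \<open>t\<close>.\<close>
  define P where "P = (\<Sum>n\<in>N. Polynomial.monom (a n) n)"
  have coeff: "Polynomial.coeff P n = (if n \<in> N then a n else 0)" for n
    using fin by (simp add: P_def Polynomial.coeff_sum)
  have "F n = cls P n" for n
    using a(2)[of n] by (auto simp: cls_def coeff N_def a_r_coset_type_algebra)
  moreover have "P \<in> supported_on (exps S)"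
    using a(1) by (simp add: supported_on_exps coeff)
  ultimately show "F \<in> cls ` supported_on (exps S)" by blast
next
  fix F :: "nat \<Rightarrow> 'k poly poly set" assume "F \<in> cls ` supported_on (exps S)"
  then obtain P where P: "P \<in> supported_on (exps S)" "F = cls P" by blast
  have "{n. cls P n \<noteq> mono_ideal (T n)} \<subseteq> {..Polynomial.degree P}"
    by (auto simp: cls_def a_r_coset_type_algebra intro!: le_degree)
  then have "finite {n. cls P n \<noteq> mono_ideal (T n)}"
    by (rule finite_subset) simp
  then show "F \<in> carrier Q"
    using P by (auto simp: graded_quotient_def cls_def supported_on_exps)
qed

lemma supported_on_one: "1 \<in> supported_on (exps S)"
  by (auto simp: supported_on_def coeff_txy_one exps_def S_0 zero_prod_def split: if_splits)

lemma supported_on_add: "P \<in> supported_on U \<Longrightarrow> P' \<in> supported_on U \<Longrightarrow> P + P' \<in> supported_on U"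
  unfolding supported_on_def mem_Collect_eq coeff_txy_add by (metis add_0)

lemma supported_on_uminus: "P \<in> supported_on U \<Longrightarrow> - P \<in> supported_on U"
  by (simp add: supported_on_def coeff_txy_uminus)

lemma supported_on_mult:
  assumes "P \<in> supported_on (exps S)" "P' \<in> supported_on (exps S)"
  shows "P * P' \<in> supported_on (exps S)"
  unfolding supported_on_exps coeff_mult
proof (intro allI mono_ideal_sum)
  fix n i :: nat assume "i \<in> {..n}"
  then show "Polynomial.coeff P i * Polynomial.coeff P' (n - i) \<in> mono_ideal (S n)"
    using assms S_add_S[of _ i _ "n - i"]
    by (intro mono_ideal_mult[of _ "S i" _ "S (n - i)"]) (auto simp: supported_on_exps)
qed

text \<open>The ring axioms are inherited through \<open>cls\<close> from the subring of
  \<open>K[x,y][t]\<close> of polynomials supported on \<open>exps S\<close>.\<close>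

lemma ring_Q: "ring (Q :: (nat \<Rightarrow> 'k::field poly poly set) ring)"
proof -
  let ?K = "ring_of_type_algebra :: 'k poly poly poly ring"
  let ?R = "supported_on (exps S) :: 'k poly poly poly set"
  interpret cring ?K by (rule cring_from_type_algebra)
  have neg: "\<ominus>\<^bsub>?K\<^esub> P = - P" for P
    by (rule minus_equality) simp_all
  have "subring ?R ?K"
    by (rule subringI)
      (auto simp: neg supported_on_one supported_on_add supported_on_uminus supported_on_mult)
  then interpret R: ring "?K\<lparr>carrier := ?R\<rparr>"
    by (rule subring_is_ring)
  have "cls \<in> ring_hom (?K\<lparr>carrier := ?R\<rparr>) Q"
    by (rule ring_hom_memI) (auto simp: carrier_eq cls_add cls_mult one_eq_cls)
  from R.ring_hom_imp_img_ring[OF this] show ?thesis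
    by (simp flip: carrier_eq zero_eq_cls)
qed

section \<open>The maximal homogeneous ideal and positive depth\<close>

definition max_hom :: "(nat \<Rightarrow> 'k::field poly poly set) set" where
  "max_hom = cls ` {P \<in> supported_on (exps S). coeff_txy P 0 = 0}"

lemma ideal_max_hom: "ideal max_hom (Q :: (nat \<Rightarrow> 'k::field poly poly set) ring)"
proof -
  interpret ring "Q :: (nat \<Rightarrow> 'k poly poly set) ring" by (rule ring_Q)
  have neg: "\<ominus>\<^bsub>Q\<^esub> cls P = cls (- P)" if "P \<in> supported_on (exps S)" for P :: "'k poly poly poly"
    using that supported_on_uminus[OF that] by (intro minus_equality) (auto simp: cls_add zero_eq_cls carrier_eq)
  have "subgroup max_hom (add_monoid (Q :: (nat \<Rightarrow> 'k poly poly set) ring))"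
  proof (rule add.subgroupI)
    have "cls 0 \<in> max_hom"
      by (auto simp: max_hom_def supported_on_def)
    then show "max_hom \<noteq> {}" by blast
  qed (auto simp: max_hom_def carrier_eq neg cls_add coeff_txy_add coeff_txy_uminus
      intro!: imageI supported_on_add supported_on_uminus)
  then show ?thesis
    by (rule idealI[OF ring_axioms])
      (auto simp: max_hom_def carrier_eq cls_mult coeff_txy_mult_zero intro!: imageI supported_on_mult)
qed

text \<open>If \<open>1\<close> and \<open>P\<close> had the same class with \<open>P\<close>
  lacking a constant term, then \<open>1 - P\<close> would have constant coefficient
  \<open>1\<close>, although \<open>0\<close> is not in \<open>T 0\<close>.\<close>

lemma one_notin_max_hom: "\<one>\<^bsub>Q\<^esub> \<notin> (max_hom :: (nat \<Rightarrow> 'k::field poly poly set) set)"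
proof
  assume "\<one>\<^bsub>Q\<^esub> \<in> (max_hom :: (nat \<Rightarrow> 'k poly poly set) set)"
  then obtain P :: "'k poly poly poly" where "cls 1 = cls P" "coeff_txy P 0 = 0"
    by (auto simp: max_hom_def one_eq_cls)
  then have "0 \<in> exps T"
    unfolding cls_eq_iff supported_on_def by (simp add: coeff_txy_diff coeff_txy_one del: split_paired_All)
  then show False
    using zero_notin_T by (simp add: exps_def)
qed

text \<open>Since \<open>0\<close> is not in \<open>T 0\<close>, vanishing of the constant
  coefficient depends only on the class in degree zero. This links \<open>max_hom\<close> to the
  ideals used for the two depths.\<close>

lemma max_hom_eq:
  "max_hom = {F \<in> carrier Q.
    F 0 \<in> (\<lambda>a. mono_ideal (T 0) +>\<^bsub>Kxy\<^esub> a) ` (mono_ideal (UNIV - {0}) :: 'k::field poly poly set)}"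
proof -
  have "coeff_txy P 0 = 0 \<longleftrightarrow>
      cls P 0 \<in> (\<lambda>a. mono_ideal (T 0) +>\<^bsub>Kxy\<^esub> a) ` mono_ideal (UNIV - {0})" for P :: "'k poly poly poly"
  proof -
    have T_0: "(mono_ideal (T 0) :: 'k poly poly set) \<subseteq> mono_ideal (UNIV - {0})"
      using zero_notin_T by (intro mono_ideal_mono) auto
    have "coeff_txy P 0 = 0 \<longleftrightarrow> Polynomial.coeff P 0 \<in> mono_ideal (UNIV - {0})"
      by (auto simp: coeff_txy_def mono_ideal_def zero_prod_def intro!: gr0I)
    also have "\<dots> \<longleftrightarrow> (\<exists>a\<in>mono_ideal (UNIV - {0}). Polynomial.coeff P 0 - a \<in> mono_ideal (T 0))"
      using T_0 mono_ideal_add[of _ "UNIV - {0}" "Polynomial.coeff P 0 - _"]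
      by (metis (no_types, lifting) add.commute cancel_comm_monoid_add_class.diff_cancel diff_add_cancel mono_ideal_zero subsetD)
    finally show ?thesis
      by (auto simp: cls_def coset_eq_iff)
  qed
  then show ?thesis
    unfolding max_hom_def carrier_eq by auto
qed

lemma cls_eq_zero_iff: "cls P = \<zero>\<^bsub>Q\<^esub> \<longleftrightarrow> P \<in> supported_on (exps T)"
  by (simp add: zero_eq_cls cls_eq_iff)

text \<open>A monomial killed by all nonunit monomials is killed by all of \<open>max_hom\<close>,
  which then has no nonzerodivisor. Without such a monomial, the sum of the monomials in
  \<open>G\<close> is one: by \<open>gen\<close> the finite set \<open>G\<close> already detects
  whether some nonunit monomial survives.\<close>

lemma depth_pos_iff_no_socle:
  assumes G: "finite G" "G \<subseteq> exps S - {0}"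
    and gen: "\<And>e g. e \<in> exps S - exps T \<Longrightarrow> g \<in> exps S - {0} \<Longrightarrow> g + e \<notin> exps T
      \<Longrightarrow> \<exists>h\<in>G. h + e \<notin> exps T"
  shows "depth (Q :: (nat \<Rightarrow> 'k::field poly poly set) ring) max_hom > 0 \<longleftrightarrow>
    (\<forall>e\<in>exps S - exps T. \<exists>g\<in>exps S - {0}. g + e \<notin> exps T)"
proof -
  let ?Q = "Q :: (nat \<Rightarrow> 'k poly poly set) ring"
  have "depth ?Q max_hom > 0 \<longleftrightarrow> (\<exists>a\<in>max_hom. nonzerodivisor ?Q a)"
    using one_notin_max_hom ring.ring_simprules(6)[OF ring_Q]
    by (intro depth_pos_iff ring_Q ideal_max_hom) blast
  also have "\<dots> \<longleftrightarrow> (\<forall>e\<in>exps S - exps T. \<exists>g\<in>exps S - {0}. g + e \<notin> exps T)"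
  proof
    assume "\<exists>a\<in>max_hom. nonzerodivisor ?Q a"
    then obtain P :: "'k poly poly poly"
      where P: "P \<in> supported_on (exps S)" "coeff_txy P 0 = 0" "nonzerodivisor Q (cls P)"
      by (auto simp: max_hom_def)
    show "\<forall>e\<in>exps S - exps T. \<exists>g\<in>exps S - {0}. g + e \<notin> exps T"
    proof (rule ballI, rule ccontr)
      fix e assume e: "e \<in> exps S - exps T" and socle: "\<not> (\<exists>g\<in>exps S - {0}. g + e \<notin> exps T)"
      have me: "(monomial e :: 'k poly poly poly) \<in> supported_on (exps S)"
        using e by (simp add: monomial_in_supported_on_iff)
      have "monomial e * P \<in> supported_on (exps T)"
        unfolding supported_on_def
      proof (intro CollectI allI impI)
        fix a assume "coeff_txy (monomial e * P) a \<noteq> 0"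
        then obtain b where "a = e + b" "coeff_txy P b \<noteq> 0"
          by (rule coeff_txy_monomial_mult_nonzero)
        moreover from this have "b \<in> exps S - {0}"
          using P(1,2) by (auto simp: supported_on_def simp del: split_paired_All)
        ultimately show "a \<in> exps T"
          using socle by (auto simp: add.commute)
      qed
      then have "cls P \<otimes>\<^bsub>?Q\<^esub> cls (monomial e) = \<zero>\<^bsub>?Q\<^esub>"
        by (simp add: cls_mult P me cls_eq_zero_iff mult.commute)
      then have "cls (monomial e) = \<zero>\<^bsub>?Q\<^esub>"
        using P(3) me by (auto simp: nonzerodivisor_def carrier_eq)
      then have "e \<in> exps T"
        by (simp add: cls_eq_zero_iff monomial_in_supported_on_iff)
      with e show False by simp
    qed
  next
    assume no_socle: "\<forall>e\<in>exps S - exps T. \<exists>g\<in>exps S - {0}. g + e \<notin> exps T"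
    define \<theta> :: "'k poly poly poly" where "\<theta> = (\<Sum>g\<in>G. monomial g)"
    have \<theta>: "\<theta> \<in> supported_on (exps S)" "coeff_txy \<theta> 0 = 0"
      using G by (auto simp: \<theta>_def supported_on_def coeff_txy_sum coeff_txy_monomial)
    have "P \<in> supported_on (exps T)"
      if "P \<in> supported_on (exps S)" "\<theta> * P \<in> supported_on (exps T)" for P
    proof (rule sum_monomials_nonzerodivisor)
      show "\<exists>g\<in>G. g + e \<notin> exps T" if "e \<in> exps S - exps T" for e
        using no_socle gen that by blast
      show "(\<Sum>g\<in>G. monomial g) * P \<in> supported_on (exps T)"
        using that(2) by (simp add: \<theta>_def)
    qed (use that(1) G exps_T_subset in \<open>auto intro: exps_add exps_add_T simp del: split_paired_All\<close>)
    then have "nonzerodivisor ?Q (cls \<theta>)"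
      using \<theta> by (auto simp: nonzerodivisor_def carrier_eq cls_mult cls_eq_zero_iff)
    then show "\<exists>a\<in>max_hom. nonzerodivisor ?Q a"
      using \<theta> by (auto simp: max_hom_def)
  qed
  finally show ?thesis .
qed

end

section \<open>Variables, maximal ideal and homogeneous components in terms of exponents\<close>

lemma var_power_mult: "var_x ^ i * var_y ^ j = Polynomial.monom (Polynomial.monom 1 j) i"
  by (simp add: var_x_def var_y_def monom_power poly_const_pow mult_monom flip: monom_0)

text \<open>A nonzero exponent has a positive component, so its monomial is divisible by
  \<open>x\<close> or by \<open>y\<close>.\<close>

lemma max_ideal_eq: "max_ideal = (mono_ideal (UNIV - {0}) :: 'k::field poly poly set)"
proof
  interpret cring "Kxy :: 'k poly poly ring" by (rule cring_from_type_algebra)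
  have "ideal (mono_ideal (UNIV - {0})) (Kxy :: 'k poly poly ring)"
    by (rule ideal_mono_ideal) (auto simp: zero_prod_def)
  moreover have "{var_x, var_y} \<subseteq> (mono_ideal (UNIV - {0}) :: 'k poly poly set)"
    using mono_ideal_monom[of "1 :: 'k" 0 1 "UNIV - {0}"] mono_ideal_monom[of "1 :: 'k" 1 0 "UNIV - {0}"]
    by (simp add: var_x_def var_y_def zero_prod_def monom_0 flip: one_pCons)
  ultimately show "max_ideal \<subseteq> (mono_ideal (UNIV - {0}) :: 'k poly poly set)"
    unfolding max_ideal_def by (rule genideal_minimal)
  interpret M: ideal max_ideal "Kxy :: 'k poly poly ring"
    unfolding max_ideal_def by (rule genideal_ideal) simp
  have var: "(var_x :: 'k poly poly) \<in> max_ideal" "(var_y :: 'k poly poly) \<in> max_ideal"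
    unfolding max_ideal_def using genideal_self[of "{var_x, var_y :: 'k poly poly}"] by auto
  show "(mono_ideal (UNIV - {0}) :: 'k poly poly set) \<subseteq> max_ideal"
  proof
    fix f :: "'k poly poly" assume "f \<in> mono_ideal (UNIV - {0})"
    then show "f \<in> max_ideal"
    proof (induction rule: mono_ideal_induct)
      case zero
      show ?case using M.zero_closed unfolding Kxy_simps .
    next
      case (add g h)
      then show ?case using M.a_closed[of g h] by simp
    next
      case (monom c i j)
      show ?case
      proof (cases i)
        case (Suc i')
        have "Polynomial.monom (Polynomial.monom c j) i' * var_x \<in> max_ideal"
          using M.I_l_closed[OF var(1)] by simp
        then show ?thesis by (simp add: Suc var_x_def mult_monom)
      next
        case 0
        with monom obtain j' where "j = Suc j'" by (cases j) (auto simp: zero_prod_def)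
        moreover have "Polynomial.monom (Polynomial.monom c j') 0 * var_y \<in> max_ideal"
          using M.I_l_closed[OF var(2)] by simp
        ultimately show ?thesis by (simp add: 0 var_y_def mult_monom flip: monom_0)
      qed
    qed
  qed
qed

lemma coeff_hom_component:
  "coeff_xy (hom_component e f) i j = (if i + j = e then coeff_xy f i j else 0)"
proof -
  have "hom_component e f = (\<Sum>i\<le>e. Polynomial.monom (Polynomial.monom (coeff_xy f i (e - i)) (e - i)) i)"
    by (simp add: hom_component_def var_power_mult smult_monom)
  then show ?thesis
    by (auto simp: Polynomial.coeff_sum if_distrib[of "\<lambda>p. Polynomial.coeff p j"] cong: if_cong)
qed

lemma K_span_subset_mono_ideal:
  assumes "B \<subseteq> mono_ideal U"
  shows "K_span B \<subseteq> (mono_ideal U :: 'k::field poly poly set)"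
proof -
  interpret vector_space "\<lambda>c f :: 'k poly poly. Polynomial.smult [:c:] f"
    by (rule vector_space_Kxy)
  have "subspace (mono_ideal U)"
    by (auto simp: subspace_def mono_ideal_add) (auto simp: mono_ideal_def)
  from span_minimal[OF assms this] show ?thesis
    by (simp add: K_span_def)
qed

lemma K_span_superset: "B \<subseteq> K_span (B :: 'k::field poly poly set)"
proof -
  interpret vector_space "\<lambda>c f :: 'k poly poly. Polynomial.smult [:c:] f"
    by (rule vector_space_Kxy)
  show ?thesis
    using span_superset[of B] by (simp add: K_span_def)
qed

section \<open>Lex-segment ideals\<close>

text \<open>The component of \<open>f\<close> in degree \<open>i + j\<close> lies in the span of an
  initial segment ending at some power \<open>l\<close> of \<open>y\<close>. The nonzero coefficient
  forces \<open>j \<le> l\<close>, so the segment contains every monomial of that degree with at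
  most \<open>j\<close> factors \<open>y\<close>.\<close>

lemma lex_segment_ideal_monomials:
  assumes I: "lex_segment_ideal I" and f: "f \<in> I" "coeff_xy f i j \<noteq> 0" and j': "j' \<le> j" "i' + j' = i + j"
  shows "var_x ^ i' * var_y ^ j' \<in> I"
proof -
  let ?h = "hom_component (i + j) f" and ?m = "\<lambda>a. var_x ^ (i + j - a) * var_y ^ a"
  have h: "?h \<in> I \<inter> forms (i + j)"
    using I f(1) by (auto simp: lex_segment_ideal_def graded_ideal_def forms_def coeff_hom_component split: if_splits)
  have ij: "coeff_xy ?h i j \<noteq> 0"
    using f(2) by (simp add: coeff_hom_component)
  have "I \<inter> forms (i + j) \<noteq> {0}"
    using h ij by (metis Polynomial.coeff_0 singletonD)
  then obtain l where l: "I \<inter> forms (i + j) = K_span (?m ` {..l})"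
    using I unfolding lex_segment_ideal_def by blast
  have "?m ` {..l} \<subseteq> mono_ideal {(i + j - a, a) |a. a \<le> l}"
    by (auto simp: var_power_mult mono_ideal_monom)
  then have "?h \<in> mono_ideal {(i + j - a, a) |a. a \<le> l}"
    using h l K_span_subset_mono_ideal by blast
  then have "j \<le> l"
    using ij by (auto simp: mono_ideal_def)
  then have "?m j' \<in> I \<inter> forms (i + j)"
    unfolding l using j'(1) K_span_superset[of "?m ` {..l}"] by auto
  moreover have "i' = i + j - j'"
    using j' by simp
  ultimately show ?thesis by simp
qed

text \<open>In two variables, stability under trading a \<open>y\<close> for an \<open>x\<close>
  says that the monomials of each degree form an initial lex segment. The last two conditions
  express that the ideal is nonzero and proper.\<close>

locale strongly_stable =
  fixes U :: "(nat \<times> nat) set"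
  assumes up: "u \<in> U \<Longrightarrow> u + v \<in> U"
    and exchange: "(i, Suc j) \<in> U \<Longrightarrow> (Suc i, j) \<in> U"
    and nonempty: "U \<noteq> {}" and zero_notin: "0 \<notin> U"

lemma lex_segment_ideal_strongly_stable:
  fixes I :: "'k::field poly poly set"
  assumes "lex_segment_ideal I"
  obtains U where "strongly_stable U" "I = mono_ideal U"
proof -
  interpret I: ideal I "Kxy :: 'k poly poly ring"
    using assms by (simp add: lex_segment_ideal_def graded_ideal_def)
  define U where "U = {u. var_x ^ fst u * var_y ^ snd u \<in> I}"
  have mult: "g * f \<in> I" if "f \<in> I" for f g :: "'k poly poly"
    using I.I_l_closed[OF that, of g] by simp
  have eq: "I = mono_ideal U"
  proof (intro equalityI subsetI)
    fix f :: "'k poly poly" assume "f \<in> I"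
    then show "f \<in> mono_ideal U"
      using lex_segment_ideal_monomials[OF assms] by (auto simp: mono_ideal_def U_def)
  next
    fix f :: "'k poly poly" assume "f \<in> mono_ideal U"
    then show "f \<in> I"
    proof (induction rule: mono_ideal_induct)
      case zero
      show ?case using additive_subgroup.zero_closed[OF I.additive_subgroup_axioms] by simp
    next
      case (add g h)
      then show ?case using additive_subgroup.a_closed[OF I.additive_subgroup_axioms, of g h] by simp
    next
      case (monom c i j)
      then show ?case
        using mult[of "var_x ^ i * var_y ^ j" "Polynomial.monom (Polynomial.monom c 0) 0"]
        by (simp add: U_def var_power_mult mult_monom)
    qed
  qed
  have "strongly_stable U"
  proof
    show "u + v \<in> U" if "u \<in> U" for u v
      using mult[of "var_x ^ fst u * var_y ^ snd u" "var_x ^ fst v * var_y ^ snd v"] that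
      by (simp add: U_def power_add mult_ac)
    show "(Suc i, j) \<in> U" if "(i, Suc j) \<in> U" for i j
      using that lex_segment_ideal_monomials[OF assms, of "var_x ^ i * var_y ^ Suc j" i "Suc j" j "Suc i"]
      unfolding U_def by (auto simp: var_power_mult simp del: power_Suc)
    have "I \<noteq> {0}" "I \<noteq> UNIV"
      using assms by (auto simp: lex_segment_ideal_def)
    then show "U \<noteq> {}"
      by (auto simp: eq mono_ideal_def poly_eq_iff)
    show "0 \<notin> U"
    proof
      assume "0 \<in> U"
      then have "1 \<in> I" by (simp add: U_def)
      then have "g \<in> I" for g
        using mult[of 1 g] by simp
      with \<open>I \<noteq> UNIV\<close> show False by blast
    qed
  qed
  with eq show thesis by (rule that[rotated])
qed

section \<open>Powers of a strongly stable ideal\<close>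

context strongly_stable
begin

abbreviation "SP \<equiv> sumset_power U"

text \<open>The exponents of \<open>\<M> I\<^sup>n\<close>.\<close>

abbreviation "MP n \<equiv> sumset (UNIV - {0}) (SP n)"

lemma SP_up: "u \<in> SP n \<Longrightarrow> u + v \<in> SP n"
proof (cases n)
  case (Suc m)
  assume "u \<in> SP n"
  then obtain a b where "a \<in> SP m" "b \<in> U" "u = a + b"
    by (auto simp: Suc sumset_def)
  then show ?thesis
    using sumsetI[of a "SP m" "b + v" U] up by (simp add: Suc add.assoc)
qed simp

lemma SP_up': "u \<in> SP n \<Longrightarrow> v + u \<in> SP n"
  using SP_up by (simp add: add.commute)

lemma SP_add: "u \<in> SP m \<Longrightarrow> v \<in> SP n \<Longrightarrow> u + v \<in> SP (m + n)"
proof (induction n arbitrary: v)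
  case 0
  then show ?case by (simp add: SP_up)
next
  case (Suc n)
  then obtain a b where "a \<in> SP n" "b \<in> U" "v = a + b"
    by (auto simp: sumset_def)
  then show ?case
    using sumsetI[of "u + a" "SP (m + n)" b U] Suc by (simp add: add.assoc)
qed

text \<open>The summand \<open>SP 0 = UNIV\<close> is absorbed by \<open>U\<close>.\<close>

lemma SP_1: "SP (Suc 0) = U"
proof
  show "SP (Suc 0) \<subseteq> U"
  proof
    fix w assume "w \<in> SP (Suc 0)"
    then obtain v u where "u \<in> U" "w = v + u"
      by (auto simp: sumset_def)
    then show "w \<in> U"
      using up[of u v] by (simp add: add.commute)
  qed
  show "U \<subseteq> SP (Suc 0)"
    using sumsetI[of 0 UNIV _ U] by auto
qed

lemma SP_Suc_subset: "SP (Suc n) \<subseteq> SP n"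
  unfolding sumset_power.simps sumset_def using SP_up by blast

lemma SP_antimono: "m \<le> n \<Longrightarrow> SP n \<subseteq> SP m"
  by (rule lift_Suc_antimono_le[of SP, OF SP_Suc_subset])

text \<open>The trade is made in whichever factor contains a \<open>y\<close>: in the one from
  \<open>U\<close> if \<open>b = 0\<close>, otherwise in the lower power by induction.\<close>

lemma SP_exchange: "(i, Suc j) \<in> SP n \<Longrightarrow> (Suc i, j) \<in> SP n"
proof (induction n arbitrary: i j)
  case (Suc n)
  then obtain a b c d where *: "(a, b) \<in> SP n" "(c, d) \<in> U" "i = a + c" "Suc j = b + d"
    by (auto simp: sumset_def)
  show ?case
  proof (cases b)
    case 0
    then show ?thesis
      using * exchange[of c j] sumsetI[of "(a, b)" "SP n" "(Suc c, j)" U] by simp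
  next
    case (Suc b')
    then show ?thesis
      using * Suc.IH[of a b'] sumsetI[of "(Suc a, b')" "SP n" "(c, d)" U] by simp
  qed
qed simp

lemma MP_subset: "MP n \<subseteq> SP n"
  unfolding sumset_def using SP_up' by blast

lemma MPI: "u \<in> SP n \<Longrightarrow> v \<noteq> 0 \<Longrightarrow> v + u \<in> MP n"
  by (rule sumsetI) auto

lemma SP_add_MP: "u \<in> SP m \<Longrightarrow> v \<in> MP n \<Longrightarrow> u + v \<in> MP (m + n)"
proof -
  assume u: "u \<in> SP m" and "v \<in> MP n"
  then obtain a b where "a \<noteq> 0" "b \<in> SP n" "v = a + b"
    unfolding sumset_def by blast
  then show ?thesis
    using MPI[OF SP_add[OF u], of b n a] by (simp add: add.left_commute)
qed

text \<open>Division by \<open>y\<close> maps monomials of \<open>\<M> I^n\<close> divisible by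
  \<open>y\<close> into \<open>I^n\<close>. If the factor from \<open>\<M>\<close> contains
  \<open>y\<close>, it is cancelled there. Otherwise that factor contains \<open>x\<close>, and this
  \<open>x\<close> is used to replace a \<open>y\<close> in the factor from
  \<open>I^n\<close>.\<close>

lemma MP_Suc_snd: "(i, Suc j) \<in> MP n \<Longrightarrow> (i, j) \<in> SP n"
proof -
  assume "(i, Suc j) \<in> MP n"
  then obtain a b c d where *: "(a, b) \<noteq> 0" "(c, d) \<in> SP n" "i = a + c" "Suc j = b + d"
    by (auto simp: sumset_def)
  show ?thesis
  proof (cases b)
    case (Suc b')
    then show ?thesis
      using * SP_up'[of "(c, d)" n "(a, b')"] by simp
  next
    case 0
    with * obtain a' where "a = Suc a'" by (cases a) (auto simp: zero_prod_def)
    then show ?thesis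
      using * 0 SP_exchange[of c j n] SP_up'[of "(Suc c, j)" n "(a', 0)"] by simp
  qed
qed

section \<open>Initial degree and minimal generators\<close>

lemma exchange_all: "(i, j) \<in> U \<Longrightarrow> (i + j, 0) \<in> U"
proof (induction j arbitrary: i)
  case (Suc j)
  then show ?case using Suc.IH[OF exchange] by simp
qed simp

text \<open>The initial degree of the ideal: trading every \<open>y\<close> for an \<open>x\<close>
  shows that the least degree is attained by a power of \<open>x\<close>.\<close>

definition "d = (LEAST d. (d, 0) \<in> U)"

lemma d: "(d, 0) \<in> U"
proof -
  obtain i j where "(i, j) \<in> U"
    using nonempty by auto
  then show ?thesis
    unfolding d_def by (rule LeastI[where P = "\<lambda>d. (d, 0) \<in> U", OF exchange_all])
qed

lemma d_le: "(i, j) \<in> U \<Longrightarrow> d \<le> i + j"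
  unfolding d_def by (rule Least_le) (rule exchange_all)

lemma SP_degree: "(i, j) \<in> SP n \<Longrightarrow> n * d \<le> i + j"
proof (induction n arbitrary: i j)
  case (Suc n)
  then obtain a b c e where "(a, b) \<in> SP n" "(c, e) \<in> U" "i = a + c" "j = b + e"
    by (auto simp: sumset_def)
  then show ?case
    using Suc.IH[of a b] d_le[of c e] by simp
qed simp

lemma SP_d: "(n * d, 0) \<in> SP n"
proof (induction n)
  case (Suc n)
  then show ?case
    using sumsetI[OF Suc d] by (simp add: add.commute)
qed simp

definition "min_gens = U - sumset (UNIV - {0}) U"

text \<open>A minimal generator other than \<open>x^d\<close> is no multiple of \<open>x^d\<close>,
  which bounds its power of \<open>x\<close> by \<open>d\<close>; two generators with the same power
  of \<open>x\<close> would divide one another.\<close>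

lemma finite_min_gens: "finite min_gens"
proof -
  have notin: "v + u \<notin> min_gens" if "u \<in> U" "v \<noteq> 0" for u v
    using that by (auto simp: min_gens_def intro: sumsetI)
  have "fst ` min_gens \<subseteq> {..d}"
  proof clarsimp
    fix i j assume "(i, j) \<in> min_gens"
    then show "i \<le> d"
      using notin[OF d, of "(i - d, j)"] by (cases "i \<le> d") (auto simp: zero_prod_def)
  qed
  moreover have "inj_on fst min_gens"
  proof (rule inj_onI, clarsimp)
    have "\<not> j < j'" if "(i, j) \<in> min_gens" "(i, j') \<in> min_gens" for i j j'
      using that notin[of "(i, j)" "(0, j' - j)"] by (auto simp: min_gens_def zero_prod_def)
    then show "j = j'" if "(i, j) \<in> min_gens" "(i, j') \<in> min_gens" for i j j'
      using that by (meson linorder_less_linear)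
  qed
  ultimately show ?thesis
    by (meson finite_atMost finite_imageD finite_subset)
qed

lemma in_U_cases:
  assumes "u \<in> U"
  obtains "u \<in> min_gens" | c u' where "c \<noteq> 0" "u' \<in> U" "u = c + u'"
  using assms unfolding min_gens_def sumset_def by blast

sublocale gr: monomial_quotient SP "\<lambda>n. SP (Suc n)"
proof
  show "SP (Suc n) \<subseteq> SP n" for n by (rule SP_Suc_subset)
  show "0 \<notin> SP (Suc 0)" using zero_notin SP_1 by metis
  show "u + v \<in> SP (Suc (m + n))" if "u \<in> SP m" "v \<in> SP (Suc n)" for u v m n
    using SP_add[OF that] by simp
qed (auto intro: SP_add simp del: split_paired_All)

sublocale fiber: monomial_quotient SP MP
proof
  show "0 \<notin> MP 0" by (auto simp: sumset_def zero_prod_def)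
qed (auto intro: SP_add SP_add_MP subsetD[OF MP_subset] simp del: split_paired_All)

section \<open>Comparison of the socles\<close>

text \<open>Combinatorial form of positive depth. The condition \<open>(l, w) \<noteq> 0\<close>
  excludes only the unit monomial, so \<open>l = 0\<close> with \<open>w \<noteq> 0\<close> accounts
  for \<open>\<M>/I\<close>.\<close>

definition gr_no_socle :: bool where
  "gr_no_socle \<longleftrightarrow> (\<forall>n. \<forall>v\<in>SP n - SP (Suc n).
     \<exists>l. \<exists>w\<in>SP l. (l, w) \<noteq> 0 \<and> w + v \<notin> SP (Suc (l + n)))"

text \<open>For \<open>l = 0\<close> and \<open>w \<noteq> 0\<close> the product always lies in
  \<open>MP n\<close>, so a surviving multiplier necessarily has \<open>l > 0\<close>.\<close>

definition fiber_no_socle :: bool where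
  "fiber_no_socle \<longleftrightarrow> (\<forall>n. \<forall>u\<in>SP n - MP n.
     \<exists>l. \<exists>w\<in>SP l. (l, w) \<noteq> 0 \<and> w + u \<notin> MP (l + n))"

text \<open>The set \<open>G\<close> consists of \<open>x\<close> and \<open>y\<close> in degree
  zero and the minimal generators of the ideal in degree one. A monomial killed by all of these is
  killed by every nonunit monomial.\<close>

lemma gr_depth:
  "depth gr.Q (gr.max_hom :: (nat \<Rightarrow> 'k::field poly poly set) set) > 0 \<longleftrightarrow> gr_no_socle"
proof -
  define G where "G = {(0, 1, 0), (0, 0, 1)} \<union> Pair (1::nat) ` min_gens"
  have "\<exists>h\<in>G. h + e \<notin> gr.exps (\<lambda>n. SP (Suc n))"
    if e: "e \<in> gr.exps SP - gr.exps (\<lambda>n. SP (Suc n))" and g: "g \<in> gr.exps SP - {0}"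
      and ge: "g + e \<notin> gr.exps (\<lambda>n. SP (Suc n))" for e g
  proof (rule ccontr)
    assume "\<not> ?thesis"
    then have G: "h + e \<in> gr.exps (\<lambda>n. SP (Suc n))" if "h \<in> G" for h
      using that by blast
    obtain n v where e_eq: "e = (n, v)" by (cases e)
    obtain l w where g_eq: "g = (l, w)" by (cases g)
    have x: "(1, 0) + v \<in> SP (Suc n)" and y: "(0, 1) + v \<in> SP (Suc n)"
      using G[of "(0, 1, 0)"] G[of "(0, 0, 1)"] by (auto simp: G_def gr.exps_def e_eq)
    have m: "c + v \<in> SP (Suc n)" if "c \<noteq> 0" for c
    proof -
      obtain i j where c: "c = (i, j)" by (cases c)
      show ?thesis
      proof (cases i)
        case (Suc i')
        then show ?thesis using SP_up'[OF x, of "(i', j)"] by (cases v) (simp add: c)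
      next
        case 0
        with that c obtain j' where "j = Suc j'" by (cases j) (auto simp: zero_prod_def)
        then show ?thesis using 0 SP_up'[OF y, of "(0, j')"] by (cases v) (simp add: c)
      qed
    qed
    have "w + v \<in> SP (Suc (l + n))"
    proof (cases l)
      case 0
      then show ?thesis using m[of w] g by (simp add: g_eq zero_prod_def)
    next
      case (Suc l')
      then obtain a s where a: "a \<in> SP l'" and s: "s \<in> U" and w: "w = a + s"
        using g by (auto simp: g_eq gr.exps_def sumset_def)
      have "s + v \<in> SP (Suc (Suc n))"
        using s
      proof (cases rule: in_U_cases)
        case 1
        then show ?thesis using G[of "(1, s)"] by (auto simp: G_def gr.exps_def e_eq)
      next
        \<comment> \<open>The factor \<open>c\<close> alone already raises \<open>v\<close> to
          \<open>SP (Suc n)\<close>, and \<open>s'\<close> raises the result once more.\<close>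
        case (2 c s')
        then show ?thesis
          using sumsetI[OF m[OF 2(1)] 2(2)] by (simp add: add_ac)
      qed
      from SP_add[OF a this] show ?thesis by (simp add: w Suc add.assoc)
    qed
    with ge show False by (simp add: g_eq e_eq gr.exps_def)
  qed
  moreover have "finite G" "G \<subseteq> gr.exps SP - {0}"
    using finite_min_gens SP_1 by (auto simp: G_def gr.exps_def zero_prod_def min_gens_def)
  ultimately show ?thesis
    by (subst gr.depth_pos_iff_no_socle[of G]) (auto simp: gr_no_socle_def gr.exps_def Ball_def Bex_def)
qed

text \<open>Here the minimal generators in degree one suffice: nonunit monomials of degree zero
  vanish in the fiber cone, and so does every element of \<open>U\<close> that is not a minimal
  generator.\<close>

lemma fiber_depth:
  "depth fiber.Q (fiber.max_hom :: (nat \<Rightarrow> 'k::field poly poly set) set) > 0 \<longleftrightarrow> fiber_no_socle"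
proof -
  define G where "G = Pair (1::nat) ` min_gens"
  have "\<exists>h\<in>G. h + e \<notin> fiber.exps MP"
    if e: "e \<in> fiber.exps SP - fiber.exps MP" and g: "g \<in> fiber.exps SP - {0}"
      and ge: "g + e \<notin> fiber.exps MP" for e g
  proof (rule ccontr)
    assume "\<not> ?thesis"
    then have G: "h + e \<in> fiber.exps MP" if "h \<in> G" for h
      using that by blast
    obtain n v where e_eq: "e = (n, v)" by (cases e)
    obtain l w where g_eq: "g = (l, w)" by (cases g)
    have v: "v \<in> SP n" using e by (simp add: e_eq fiber.exps_def)
    have "w + v \<in> MP (l + n)"
    proof (cases l)
      case 0
      then show ?thesis using MPI[OF v, of w] g by (simp add: g_eq zero_prod_def)
    next
      case (Suc l')
      then obtain a s where a: "a \<in> SP l'" and s: "s \<in> U" and w: "w = a + s"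
        using g by (auto simp: g_eq fiber.exps_def sumset_def)
      have "s + v \<in> MP (Suc n)"
        using s
      proof (cases rule: in_U_cases)
        case 1
        then show ?thesis using G[of "(1, s)"] by (auto simp: G_def fiber.exps_def e_eq)
      next
        case (2 c s')
        then show ?thesis
          using MPI[of "v + s'" "Suc n" c] sumsetI[OF v 2(2)] by (simp add: add_ac)
      qed
      from SP_add_MP[OF a this] show ?thesis by (simp add: w Suc add.assoc)
    qed
    with ge show False by (simp add: g_eq e_eq fiber.exps_def)
  qed
  moreover have "finite G" "G \<subseteq> fiber.exps SP - {0}"
    using finite_min_gens SP_1 by (auto simp: G_def fiber.exps_def zero_prod_def min_gens_def)
  ultimately show ?thesis
    by (subst fiber.depth_pos_iff_no_socle[of G]) (auto simp: fiber_no_socle_def fiber.exps_def Ball_def Bex_def)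
qed

text \<open>Each direction turns a socle monomial of one ring into one of the other. Multiplication
  by \<open>y\<close> carries \<open>I^n\<close> into \<open>\<M> I^n\<close>, and
  \<open>MP_Suc_snd\<close> allows division by \<open>y\<close> in return.\<close>

lemma no_socle_iff: "gr_no_socle \<longleftrightarrow> fiber_no_socle"
proof
  assume fiber: fiber_no_socle
  show gr_no_socle
    unfolding gr_no_socle_def
  proof (intro allI ballI, rule ccontr)
    fix n v assume v: "v \<in> SP n - SP (Suc n)"
      and socle: "\<not> (\<exists>l. \<exists>w\<in>SP l. (l, w) \<noteq> 0 \<and> w + v \<notin> SP (Suc (l + n)))"
    obtain i j where ij: "v = (i, j)" by (cases v)
    have "(0, 1) + v \<in> SP (Suc n)"
      using socle[simplified, rule_format, of "(0, 1)" 0] by (auto simp: zero_prod_def)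
    \<comment> \<open>Otherwise dividing by \<open>y\<close> would put \<open>v\<close> into
      \<open>SP (Suc n)\<close>. Thus \<open>v y\<close> is a nonzero monomial of the fiber cone in
      degree \<open>n + 1\<close>.\<close>
    moreover have "(0, 1) + v \<notin> MP (Suc n)"
      using v MP_Suc_snd[of i j "Suc n"] by (auto simp: ij)
    ultimately obtain l w where w: "w \<in> SP l" "(l, w) \<noteq> 0" "w + ((0, 1) + v) \<notin> MP (l + Suc n)"
      using fiber unfolding fiber_no_socle_def by blast
    have "w + v \<in> SP (l + Suc n)"
      using socle w(1,2) by auto
    from MPI[OF this, of "(0, 1)"] w(3) show False
      by (simp add: add_ac zero_prod_def)
  qed
next
  assume gr: gr_no_socle
  show fiber_no_socle
    unfolding fiber_no_socle_def
  proof (intro allI ballI, rule ccontr)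
    fix n u assume u: "u \<in> SP n - MP n"
      and socle: "\<not> (\<exists>l. \<exists>w\<in>SP l. (l, w) \<noteq> 0 \<and> w + u \<notin> MP (l + n))"
    have socle': "w + u \<in> MP (l + n)" if "w \<in> SP l" "(l, w) \<noteq> 0" for l w
      using socle that by blast
    obtain i j where ij: "u = (i, j)" by (cases u)
    show False
    proof (cases j)
      \<comment> \<open>A pure power of \<open>x\<close> cannot be divided by \<open>y\<close>.
        Being outside \<open>MP n\<close>, it must be \<open>x^(n d)\<close>; multiplying by
        \<open>x^d\<close> gives the least degree occurring in \<open>SP (Suc n)\<close>, too small
        for \<open>MP (Suc n)\<close>.\<close>
      case 0
      have "n * d \<le> i"
        using SP_degree[of i 0 n] u by (simp add: ij 0)
      moreover have "\<not> n * d < i"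
        using MPI[OF SP_d[of n], of "(i - n * d, 0)"] u by (auto simp: ij 0 zero_prod_def)
      ultimately have "i = n * d" by simp
      then have "(Suc n * d, 0) \<in> MP (Suc n)"
        using socle'[of "(d, 0)" 1] d SP_1 by (simp add: ij 0 zero_prod_def)
      then obtain a b a' b' where "(a, b) \<noteq> 0" "(a', b') \<in> SP (Suc n)" "Suc n * d = a + a'" "0 = b + b'"
        unfolding sumset_def[of "UNIV - {0}"] by auto
      then show False
        using SP_degree[of a' b' "Suc n"] by (auto simp: zero_prod_def)
    next
      case (Suc j')
      define v where "v = (i, j')"
      have u_eq: "u = (0, 1) + v" by (simp add: v_def ij Suc)
      have v_n: "v \<notin> SP n"
        using u MPI[of v n "(0, 1)"] by (auto simp: u_eq zero_prod_def)
      \<comment> \<open>The order of \<open>v\<close>, that is, the degree in which \<open>v\<close>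
        is nonzero in the associated graded ring. It exists because \<open>SP 0 = UNIV\<close> and
        \<open>v \<notin> SP n\<close> bounds the candidates.\<close>
      define m where "m = (GREATEST m. v \<in> SP m)"
      have bound: "m \<le> n" if "v \<in> SP m" for m
        using that v_n SP_antimono[of n m] by (cases "m \<le> n") auto
      have v_m: "v \<in> SP m"
        unfolding m_def by (rule GreatestI_nat[of _ 0 n]) (auto dest: bound)
      have "v \<notin> SP (Suc m)"
        using Greatest_le_nat[of "\<lambda>m. v \<in> SP m" "Suc m" n] bound by (auto simp: m_def)
      have m_n: "m < n"
        using bound[OF v_m] v_m v_n by (cases "m = n") auto
      obtain l w where w: "w \<in> SP l" "(l, w) \<noteq> 0" "w + v \<notin> SP (Suc (l + m))"
        using gr v_m \<open>v \<notin> SP (Suc m)\<close> unfolding gr_no_socle_def by blast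
      have "w + u \<in> MP (l + n)"
        by (rule socle'[OF w(1,2)])
      then have "w + v \<in> SP (l + n)"
        using MP_Suc_snd[of "fst w + i" "snd w + j'" "l + n"] by (cases w) (simp add: u_eq v_def)
      \<comment> \<open>The strict inequality \<open>m < n\<close> gives
        \<open>Suc (l + m) \<le> l + n\<close>, so \<open>w + v\<close> lies in the power that
        \<open>w\<close> was chosen to avoid.\<close>
      then show False
        using w(3) m_n SP_antimono[of "Suc (l + m)" "l + n"] by auto
    qed
  qed
qed

end

section \<open>The equivalence for lex-segment ideals\<close>

theorem theorem10:
  fixes I :: "'k::field_char_0 poly poly set"
  assumes "lex_segment_ideal I"
  shows "depth (assoc_graded_ring I) (assoc_graded_max I) > 0 \<longleftrightarrow>
         depth (fiber_cone I) (fiber_cone_max I) > 0"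
proof -
  obtain U where "strongly_stable U" and I: "I = mono_ideal U"
    using lex_segment_ideal_strongly_stable[OF assms] .
  interpret strongly_stable U by fact
  have gr: "assoc_graded_ring I = gr.Q"
    unfolding assoc_graded_ring_def I ideal_power_mono_ideal ..
  have fiber: "fiber_cone I = fiber.Q"
    by (simp add: fiber_cone_def I ideal_power_mono_ideal max_ideal_eq ideal_prod_mono_ideal)
  have "assoc_graded_max I = gr.max_hom"
    unfolding gr.max_hom_eq assoc_graded_max_def gr unfolding SP_1 max_ideal_eq I ..
  moreover have "fiber_cone_max I = fiber.max_hom"
  proof -
    \<comment> \<open>In degree zero the fiber cone is \<open>R/\<M>\<close>, where elements of
      \<open>\<M>\<close> have only the zero class. This turns the image condition of
      \<open>max_hom_eq\<close> into the equation in \<open>fiber_cone_max\<close>.\<close>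
    have MP_0: "MP 0 = UNIV - {0}"
    proof
      show "UNIV - {0} \<subseteq> MP 0"
        using MPI[of 0 0] by (auto simp del: split_paired_All)
    qed (auto simp: sumset_def zero_prod_def)
    have "mono_ideal (MP 0) +>\<^bsub>Kxy\<^esub> a = mono_ideal (MP 0)"
      if "a \<in> mono_ideal (UNIV - {0})" for a :: "'k poly poly"
      using fiber.coset_eq_iff[of 0 a 0] that unfolding MP_0 by (simp add: a_r_coset_type_algebra)
    then have "(\<lambda>a. mono_ideal (MP 0) +>\<^bsub>Kxy\<^esub> a) ` (mono_ideal (UNIV - {0}) :: 'k poly poly set)
        = (\<lambda>a. mono_ideal (MP 0)) ` (mono_ideal (UNIV - {0}) :: 'k poly poly set)"
      by (rule image_cong[OF refl])
    also have "\<dots> = {mono_ideal (MP 0)}"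
      using mono_ideal_zero by (rule image_constant)
    finally have "(\<lambda>a. mono_ideal (MP 0) +>\<^bsub>Kxy\<^esub> a) ` (mono_ideal (UNIV - {0}) :: 'k poly poly set)
      = {mono_ideal (MP 0)}" .
    moreover have "\<zero>\<^bsub>fiber.Q\<^esub> 0 = (mono_ideal (MP 0) :: 'k poly poly set)"
      by (simp add: graded_quotient_def)
    ultimately show ?thesis
      unfolding fiber.max_hom_eq fiber_cone_max_def fiber by (simp only: singleton_iff)
  qed
  ultimately show ?thesis
    by (simp only: gr fiber gr_depth fiber_depth no_socle_iff)
qed

end
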